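(* Let $\lambda\in k$. There is a one-to-one correspondence between skeletal differential 3-Lie 2-algebras with weight $\lambda$ and 3-cocycles of differential 3-Lie algebras with weight $\lambda$ (i.e. tuples consisting of a differential 3-Lie algebra of weight $\lambda$, a representation of it, and a 3-cocycle with coefficients in that representation).
   Context: $k$ is a field of characteristic 0; all vector spaces are over $k$. A 3-Lie algebra is a vector space $\mathfrak g$ with a skew-symmetric trilinear bracket satisfying $[x_1,x_2,[y_1,y_2,y_3]]=[[x_1,x_2,y_1],y_2,y_3]+[y_1,[x_1,x_2,y_2],y_3]+[y_1,y_2,[x_1,x_2,y_3]]$. A differential 3-Lie algebra with weight $\lambda$ is a 3-Lie algebra with a linear map $d=d_{\mathfrak g}:\mathfrak g\to\mathfrak g$ such that $d[x_1,x_2,x_3]=[dx_1,x_2,x_3]+[x_1,dx_2,x_3]+[x_1,x_2,dx_3]+\lambda[dx_1,dx_2,x_3]+\lambda[x_1,dx_2,dx_3]+\lambda[dx_1,x_2,dx_3]+\lambda^2[dx_1,dx_2,dx_3]$. A representation of a 3-Lie algebra $\mathfrak g$ is a vector space $V$ with a skew-symmetric bilinear map $\rho:\mathfrak g\wedge\mathfrak g\to gl(V)$ such that $\rho(x_1,x_2)\rho(x_3,x_4)=\rho([x_1,x_2,x_3],x_4)+\rho(x_3,[x_1,x_2,x_4])+\rho(x_3,x_4)\rho(x_1,x_2)$ and $\rho(x_1,[x_2,x_3,x_4])=\rho(x_3,x_4)\rho(x_1,x_2)-\rho(x_2,x_4)\rho(x_1,x_3)+\rho(x_2,x_3)\rho(x_1,x_4)$.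 A representation $(V,\rho,d_V)$ of $(\mathfrak g,d)$ has in addition a linear $d_V:V\to V$ with $d_V\rho(x_1,x_2)=\rho(dx_1,x_2)+\rho(x_1,dx_2)+\lambda\rho(dx_1,dx_2)+\rho(x_1,x_2)d_V+\lambda(\rho(dx_1,x_2)+\rho(x_1,dx_2)+\lambda\rho(dx_1,dx_2))d_V$. Put $\hat\rho(x,y)=\rho(x,y)+\lambda(\rho(dx,y)+\rho(x,dy)+\lambda\rho(dx,dy))$. 3-cocycles. Let $L=\wedge^2\mathfrak g$, $[X,Y]_F=y_1\wedge[x_1,x_2,y_2]+[x_1,x_2,y_1]\wedge y_2$ for $X=x_1\wedge x_2,Y=y_1\wedge y_2$; $[X,z]=[x_1,x_2,z]$, $\rho(X)=\rho(x_1,x_2)$. A 3-cochain is a pair $(f,g)$ with $f:\wedge^2\mathfrak g\otimes\wedge^3\mathfrak g\to V$ linear (written $f(X_1,X_2,z)$ with $X_1,X_2\in L$, skew in the last three entries) and $g:\wedge^3\mathfrak g\to V$ linear (written $g(X,z)$). For $f$ depending on $p-1$ elements of $L$ and one of $\mathfrak g$, and $X_i=x_i\wedge y_i$, put $(\partial f)(X_1,\dots,X_p,z)=\sum_{1\le i<j\le p}(-1)^i f(X_1,\dots,\hat X_i,\dots,X_{j-1},[X_i,X_j]_F,X_{j+1},\dots,X_p,z)+\sum_{i=1}^p(-1)^i f(X_1,\dots,\hat X_i,\dots,X_p,[X_i,z])+\sum_{i=1}^p(-1)^{i+1}\rho(X_i)f(X_1,\dots,\hat X_i,\dots,X_p,z)+(-1)^{p+1}\big(\rho(y_p,z)f(X_1,\dots,X_{p-1},x_p)+\rho(z,x_p)f(X_1,\dots,X_{p-1},y_p)\big)$,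 and let $\partial_\lambda$ be given by the same formula with $\hat\rho$ in place of $\rho$. For $f$ of five arguments in $\mathfrak g$, $\delta f=\sum_{k=1}^5\lambda^{k-1}f^k-d_Vf$, where $f^k$ is the sum over all choices of $k$ of the five entries of $f$ with $d$ applied to exactly the chosen entries. $(f,g)$ is a 3-cocycle if $\partial f=0$ (with $p=3$) and $\partial_\lambda g-\delta f=0$ (with $p=2$ for $g$). A 3-Lie 2-algebra is $(\mathfrak g_0,\mathfrak g_1,h,l_3,l_5)$ with vector spaces $\mathfrak g_0,\mathfrak g_1$, a linear map $h:\mathfrak g_1\to\mathfrak g_0$, completely skew-symmetric trilinear maps $l_3:\mathfrak g_i\wedge\mathfrak g_j\wedge\mathfrak g_k\to\mathfrak g_{i+j+k}$ ($0\le i+j+k\le1$), and a multilinear map $l_5:\wedge^2\mathfrak g_0\otimes\wedge^3\mathfrak g_0\to\mathfrak g_1$ (skew in its first two and in its last three arguments) such that for all $x,y,x_i\in\mathfrak g_0$, $a,b\in\mathfrak g_1$: (1) $hl_3(x,y,a)=l_3(x,y,h(a))$, $l_3(a,h(b),x)=l_3(h(a),b,x)$; (2) $hl_5(x_1,x_2,x_3,x_4,x_5)=-l_3(x_1,x_2,l_3(x_3,x_4,x_5))+l_3(x_3,l_3(x_1,x_2,x_4),x_5)+l_3(l_3(x_1,x_2,x_3),x_4,x_5)+l_3(x_3,x_4,l_3(x_1,x_2,x_5))$; (3) $l_5(h(a),x_2,x_3,x_4,x_5)=-l_3(a,x_2,l_3(x_3,x_4,x_5))+l_3(x_3,l_3(a,x_2,x_4),x_5)+l_3(l_3(a,x_2,x_3),x_4,x_5)+l_3(x_3,x_4,l_3(a,x_2,x_5))$;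 (4) $l_5(x_1,x_2,h(a),x_4,x_5)=-l_3(x_1,x_2,l_3(a,x_4,x_5))+l_3(a,l_3(x_1,x_2,x_4),x_5)+l_3(l_3(x_1,x_2,a),x_4,x_5)+l_3(a,x_4,l_3(x_1,x_2,x_5))$; (5) $l_3(l_5(x_1,x_2,x_3,x_4,x_5),x_6,x_7)+l_3(x_5,l_5(x_1,x_2,x_3,x_4,x_6),x_7)+l_3(x_1,x_2,l_5(x_3,x_4,x_5,x_6,x_7))+l_3(x_5,x_6,l_5(x_1,x_2,x_3,x_4,x_7))+l_5(x_1,x_2,l_3(x_3,x_4,x_5),x_6,x_7)+l_5(x_1,x_2,x_5,l_3(x_3,x_4,x_6),x_7)+l_5(x_1,x_2,x_5,x_6,l_3(x_3,x_4,x_7))=l_3(x_3,x_4,l_5(x_1,x_2,x_5,x_6,x_7))+l_5(l_3(x_1,x_2,x_3),x_4,x_5,x_6,x_7)+l_5(x_3,l_3(x_1,x_2,x_4),x_5,x_6,x_7)+l_5(x_3,x_4,l_3(x_1,x_2,x_5),x_6,x_7)+l_5(x_3,x_4,x_5,l_3(x_1,x_2,x_6),x_7)+l_5(x_1,x_2,x_3,x_4,l_3(x_5,x_6,x_7))+l_5(x_3,x_4,x_5,x_6,l_3(x_1,x_2,x_7))$. A differential 3-Lie 2-algebra with weight $\lambda$ is such a 3-Lie 2-algebra with linear maps $d_0:\mathfrak g_0\to\mathfrak g_0$, $d_1:\mathfrak g_1\to\mathfrak g_1$ and a completely skew-symmetric trilinear map $d_2:\wedge^3\mathfrak g_0\to\mathfrak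 g_1$ such that $d_0h=hd_1$ and, for all $x_i\in\mathfrak g_0$, $a\in\mathfrak g_1$: (6) $hd_2(x_1,x_2,x_3)+d_0l_3(x_1,x_2,x_3)=l_3(d_0x_1,x_2,x_3)+l_3(x_1,d_0x_2,x_3)+l_3(x_1,x_2,d_0x_3)+\lambda(l_3(d_0x_1,d_0x_2,x_3)+l_3(x_1,d_0x_2,d_0x_3)+l_3(d_0x_1,x_2,d_0x_3))+\lambda^2l_3(d_0x_1,d_0x_2,d_0x_3)$; (7) $d_2(x_1,x_2,h(a))+d_1l_3(x_1,x_2,a)=l_3(d_0x_1,x_2,a)+l_3(x_1,d_0x_2,a)+l_3(x_1,x_2,d_1a)+\lambda(l_3(d_0x_1,d_0x_2,a)+l_3(x_1,d_0x_2,d_1a)+l_3(d_0x_1,x_2,d_1a))+\lambda^2l_3(d_0x_1,d_0x_2,d_1a)$; (8) with $\hat l_3(x,y,a)=l_3(x,y,a)+\lambda\big(l_3(d_0x,y,a)+l_3(x,d_0y,a)+\lambda l_3(d_0x,d_0y,a)\big)$ for $x,y\in\mathfrak g_0$, $a\in\mathfrak g_1$, $d_1l_5(x_1,\dots,x_5)-\sum_{k=1}^5\lambda^{k-1}l_5^k(x_1,\dots,x_5)=d_2(x_3,l_3(x_1,x_2,x_4),x_5)+d_2(l_3(x_1,x_2,x_3),x_4,x_5)+d_2(x_3,x_4,l_3(x_1,x_2,x_5))-d_2(x_1,x_2,l_3(x_3,x_4,x_5))-\hat l_3(x_1,x_2,d_2(x_3,x_4,x_5))+\hat l_3(x_5,x_3,d_2(x_1,x_2,x_4))+\hat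 l_3(x_4,x_5,d_2(x_1,x_2,x_3))+\hat l_3(x_3,x_4,d_2(x_1,x_2,x_5))$, where $l_5^k$ is the sum over all choices of $k$ of the five entries of $l_5$ with $d_0$ applied to exactly the chosen entries. It is skeletal if $h=0$. *)

theory Defs
  imports Complex_Main
begin

section \<open>Multilinear and skew-symmetric maps\<close>

definition trilinear ::
  "('k::field \<Rightarrow> 'a::ab_group_add \<Rightarrow> 'a) \<Rightarrow> ('k \<Rightarrow> 'b::ab_group_add \<Rightarrow> 'b) \<Rightarrow>
   ('k \<Rightarrow> 'c::ab_group_add \<Rightarrow> 'c) \<Rightarrow> ('k \<Rightarrow> 'v::ab_group_add \<Rightarrow> 'v) \<Rightarrow>
   ('a \<Rightarrow> 'b \<Rightarrow> 'c \<Rightarrow> 'v) \<Rightarrow> bool" where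
  "trilinear s1 s2 s3 t f \<longleftrightarrow>
     (\<forall>y z. Vector_Spaces.linear s1 t (\<lambda>x. f x y z)) \<and>
     (\<forall>x z. Vector_Spaces.linear s2 t (\<lambda>y. f x y z)) \<and>
     (\<forall>x y. Vector_Spaces.linear s3 t (\<lambda>z. f x y z))"

definition quintilinear ::
  "('k::field \<Rightarrow> 'a::ab_group_add \<Rightarrow> 'a) \<Rightarrow> ('k \<Rightarrow> 'v::ab_group_add \<Rightarrow> 'v) \<Rightarrow>
   ('a \<Rightarrow> 'a \<Rightarrow> 'a \<Rightarrow> 'a \<Rightarrow> 'a \<Rightarrow> 'v) \<Rightarrow> bool" where
  "quintilinear s t f \<longleftrightarrow>
     (\<forall>x2 x3 x4 x5. Vector_Spaces.linear s t (\<lambda>x. f x x2 x3 x4 x5)) \<and>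
     (\<forall>x1 x3 x4 x5. Vector_Spaces.linear s t (\<lambda>x. f x1 x x3 x4 x5)) \<and>
     (\<forall>x1 x2 x4 x5. Vector_Spaces.linear s t (\<lambda>x. f x1 x2 x x4 x5)) \<and>
     (\<forall>x1 x2 x3 x5. Vector_Spaces.linear s t (\<lambda>x. f x1 x2 x3 x x5)) \<and>
     (\<forall>x1 x2 x3 x4. Vector_Spaces.linear s t (\<lambda>x. f x1 x2 x3 x4 x))"

definition skew2 :: "('a \<Rightarrow> 'a \<Rightarrow> 'v::ab_group_add) \<Rightarrow> bool" where
  "skew2 f \<longleftrightarrow> (\<forall>x y. f y x = - f x y)"

text \<open>The adjacent transpositions generate the symmetric group, so they suffice. In
  characteristic 0, a multilinear map that is skew in this sense is the same as a linear map
  on the exterior power.\<close>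

definition skew3 :: "('a \<Rightarrow> 'a \<Rightarrow> 'a \<Rightarrow> 'v::ab_group_add) \<Rightarrow> bool" where
  "skew3 f \<longleftrightarrow> (\<forall>x y z. f y x z = - f x y z \<and> f x z y = - f x y z)"

text \<open>Linear maps on \<open>\<wedge>\<^sup>2 \<otimes> \<wedge>\<^sup>3\<close>.\<close>

definition skew23 :: "('a \<Rightarrow> 'a \<Rightarrow> 'a \<Rightarrow> 'a \<Rightarrow> 'a \<Rightarrow> 'v::ab_group_add) \<Rightarrow> bool" where
  "skew23 f \<longleftrightarrow>
     (\<forall>x3 x4 x5. skew2 (\<lambda>x1 x2. f x1 x2 x3 x4 x5)) \<and> (\<forall>x1 x2. skew3 (f x1 x2))"

text \<open>\<open>entries_sum d f k\<close> is the sum, over all choices of \<open>k\<close> of the five entries of \<open>f\<close>,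
  of \<open>f\<close> with \<open>d\<close> applied to exactly the chosen entries.\<close>

definition apply_at :: "nat set \<Rightarrow> ('a \<Rightarrow> 'a) \<Rightarrow> nat \<Rightarrow> 'a \<Rightarrow> 'a" where
  "apply_at S d i x = (if i \<in> S then d x else x)"

definition entries_sum ::
  "('a \<Rightarrow> 'a) \<Rightarrow> ('a \<Rightarrow> 'a \<Rightarrow> 'a \<Rightarrow> 'a \<Rightarrow> 'a \<Rightarrow> 'v::ab_group_add) \<Rightarrow> nat \<Rightarrow>
   'a \<Rightarrow> 'a \<Rightarrow> 'a \<Rightarrow> 'a \<Rightarrow> 'a \<Rightarrow> 'v" where
  "entries_sum d f k x1 x2 x3 x4 x5 =
     (\<Sum>S | S \<subseteq> {1..5} \<and> card S = k.
        f (apply_at S d 1 x1) (apply_at S d 2 x2) (apply_at S d 3 x3)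
          (apply_at S d 4 x4) (apply_at S d 5 x5))"


section \<open>Differential 3-Lie algebras, representations and 3-cocycles\<close>

locale three_Lie_algebra = g: vector_space s
  for s :: "'k::field_char_0 \<Rightarrow> 'g::ab_group_add \<Rightarrow> 'g" +
  fixes br :: "'g \<Rightarrow> 'g \<Rightarrow> 'g \<Rightarrow> 'g"
  assumes br_trilinear: "trilinear s s s s br"
    and br_skew: "skew3 br"
    and fundamental_identity:
      "br x1 x2 (br y1 y2 y3) =
         br (br x1 x2 y1) y2 y3 + br y1 (br x1 x2 y2) y3 + br y1 y2 (br x1 x2 y3)"

locale differential_three_Lie_algebra = three_Lie_algebra s br
  for lam :: "'k::field_char_0" and s :: "'k \<Rightarrow> 'g::ab_group_add \<Rightarrow> 'g" and br +
  fixes d :: "'g \<Rightarrow> 'g"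
  assumes d_linear: "Vector_Spaces.linear s s d"
    and d_br:
      "d (br x1 x2 x3) =
         br (d x1) x2 x3 + br x1 (d x2) x3 + br x1 x2 (d x3)
         + s lam (br (d x1) (d x2) x3) + s lam (br x1 (d x2) (d x3))
         + s lam (br (d x1) x2 (d x3))
         + s (lam\<^sup>2) (br (d x1) (d x2) (d x3))"

text \<open>Below, \<open>rho x y\<close> is an endomorphism of the representation space; \<open>trilinear s s sV sV rho\<close>
  says that each \<open>rho x y\<close> is linear and that \<open>rho\<close> is bilinear.\<close>

locale three_Lie_representation = three_Lie_algebra s br + V: vector_space sV
  for s :: "'k::field_char_0 \<Rightarrow> 'g::ab_group_add \<Rightarrow> 'g" and br
    and sV :: "'k \<Rightarrow> 'v::ab_group_add \<Rightarrow> 'v" +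
  fixes rho :: "'g \<Rightarrow> 'g \<Rightarrow> 'v \<Rightarrow> 'v"
  assumes rho_trilinear: "trilinear s s sV sV rho"
    and rho_skew: "skew2 (\<lambda>x y. rho x y v)"
    and rho_rho:
      "rho x1 x2 (rho x3 x4 v) =
         rho (br x1 x2 x3) x4 v + rho x3 (br x1 x2 x4) v + rho x3 x4 (rho x1 x2 v)"
    and rho_br:
      "rho x1 (br x2 x3 x4) v =
         rho x3 x4 (rho x1 x2 v) - rho x2 x4 (rho x1 x3 v) + rho x2 x3 (rho x1 x4 v)"

text \<open>The same expression defines both \<open>\<rho>\<close>-hat and \<open>l\<^sub>3\<close>-hat.\<close>

definition hat ::
  "'k \<Rightarrow> ('k \<Rightarrow> 'v::ab_group_add \<Rightarrow> 'v) \<Rightarrow> ('g \<Rightarrow> 'g) \<Rightarrow> ('g \<Rightarrow> 'g \<Rightarrow> 'v \<Rightarrow> 'v) \<Rightarrow>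
   'g \<Rightarrow> 'g \<Rightarrow> 'v \<Rightarrow> 'v" where
  "hat lam sV d rho x y v =
     rho x y v + sV lam (rho (d x) y v + rho x (d y) v + sV lam (rho (d x) (d y) v))"

locale differential_three_Lie_representation =
  differential_three_Lie_algebra lam s br d + three_Lie_representation s br sV rho
  for lam :: "'k::field_char_0" and s :: "'k \<Rightarrow> 'g::ab_group_add \<Rightarrow> 'g" and br d
    and sV :: "'k \<Rightarrow> 'v::ab_group_add \<Rightarrow> 'v" and rho +
  fixes dV :: "'v \<Rightarrow> 'v"
  assumes dV_linear: "Vector_Spaces.linear sV sV dV"
    and dV_rho:
      "dV (rho x1 x2 v) =
         rho (d x1) x2 v + rho x1 (d x2) v + sV lam (rho (d x1) (d x2) v)
         + rho x1 x2 (dV v)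
         + sV lam (rho (d x1) x2 (dV v) + rho x1 (d x2) (dV v)
                   + sV lam (rho (d x1) (d x2) (dV v)))"

text \<open>A decomposable element \<open>x \<wedge> y\<close> of \<open>L = \<wedge>\<^sup>2 g\<close> is represented by the pair \<open>(x, y)\<close>, and a
  cochain depending on several elements of \<open>L\<close> and one of \<open>g\<close> by its values on lists of such
  pairs and an element of \<open>g\<close>.  The bracket \<open>[X, Y]\<^sub>F\<close> is a sum of two decomposable elements,
  listed by \<open>bracket_F\<close>; a cochain is evaluated on it by adding its values on the two.\<close>

definition bracket_F :: "('g \<Rightarrow> 'g \<Rightarrow> 'g \<Rightarrow> 'g) \<Rightarrow> 'g \<times> 'g \<Rightarrow> 'g \<times> 'g \<Rightarrow> ('g \<times> 'g) list" where
  "bracket_F br X Y =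
     [(fst Y, br (fst X) (snd X) (snd Y)), (br (fst X) (snd X) (fst Y), snd Y)]"

text \<open>Omission of the \<open>i\<close>-th entry, counted from 1.\<close>

definition omit :: "nat \<Rightarrow> 'a list \<Rightarrow> 'a list" where
  "omit i Xs = take (i - 1) Xs @ drop i Xs"

text \<open>The coboundary operator; \<open>p\<close> is the number of arguments from \<open>L\<close> of the result.
  The list positions \<open>Xs ! (i - 1)\<close> correspond to \<open>X\<^sub>i\<close>.\<close>

definition coboundary ::
  "('k::field_char_0 \<Rightarrow> 'v::ab_group_add \<Rightarrow> 'v) \<Rightarrow> ('g \<Rightarrow> 'g \<Rightarrow> 'g \<Rightarrow> 'g) \<Rightarrow>
   ('g \<Rightarrow> 'g \<Rightarrow> 'v \<Rightarrow> 'v) \<Rightarrow> (('g \<times> 'g) list \<Rightarrow> 'g \<Rightarrow> 'v) \<Rightarrow> ('g \<times> 'g) list \<Rightarrow> 'g \<Rightarrow> 'v" where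
  "coboundary sV br rho F Xs z =
     (let p = length Xs; x = (\<lambda>i. fst (Xs ! (i - 1))); y = (\<lambda>i. snd (Xs ! (i - 1))) in
       (\<Sum>j=1..p. \<Sum>i=1..<j. sV ((-1) ^ i)
          (\<Sum>W \<leftarrow> bracket_F br (Xs ! (i - 1)) (Xs ! (j - 1)). F (omit i (Xs[j - 1 := W])) z))
       + (\<Sum>i=1..p. sV ((-1) ^ i) (F (omit i Xs) (br (x i) (y i) z)))
       + (\<Sum>i=1..p. sV ((-1) ^ (i + 1)) (rho (x i) (y i) (F (omit i Xs) z)))
       + sV ((-1) ^ (p + 1))
           (rho (y p) z (F (omit p Xs) (x p)) + rho z (x p) (F (omit p Xs) (y p))))"

definition cochain_f ::
  "('g \<Rightarrow> 'g \<Rightarrow> 'g \<Rightarrow> 'g \<Rightarrow> 'g \<Rightarrow> 'v) \<Rightarrow> ('g \<times> 'g) list \<Rightarrow> 'g \<Rightarrow> 'v" where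
  "cochain_f f Xs z = f (fst (Xs ! 0)) (snd (Xs ! 0)) (fst (Xs ! 1)) (snd (Xs ! 1)) z"

definition cochain_g :: "('g \<Rightarrow> 'g \<Rightarrow> 'g \<Rightarrow> 'v) \<Rightarrow> ('g \<times> 'g) list \<Rightarrow> 'g \<Rightarrow> 'v" where
  "cochain_g g Xs z = g (fst (Xs ! 0)) (snd (Xs ! 0)) z"

definition delta ::
  "'k::field_char_0 \<Rightarrow> ('g \<Rightarrow> 'g) \<Rightarrow> ('k \<Rightarrow> 'v::ab_group_add \<Rightarrow> 'v) \<Rightarrow> ('v \<Rightarrow> 'v) \<Rightarrow>
   ('g \<Rightarrow> 'g \<Rightarrow> 'g \<Rightarrow> 'g \<Rightarrow> 'g \<Rightarrow> 'v) \<Rightarrow> 'g \<Rightarrow> 'g \<Rightarrow> 'g \<Rightarrow> 'g \<Rightarrow> 'g \<Rightarrow> 'v" where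
  "delta lam d sV dV f x1 x2 x3 x4 x5 =
     (\<Sum>k=1..5. sV (lam ^ (k - 1)) (entries_sum d f k x1 x2 x3 x4 x5)) - dV (f x1 x2 x3 x4 x5)"

text \<open>The multilinear maps \<open>\<partial> f\<close> and \<open>\<partial>\<^sub>\<lambda> g - \<delta> f\<close> vanish iff they vanish on decomposable
  elements of \<open>L\<close>.\<close>

locale differential_three_Lie_cocycle = differential_three_Lie_representation lam s br d sV rho dV
  for lam :: "'k::field_char_0" and s :: "'k \<Rightarrow> 'g::ab_group_add \<Rightarrow> 'g" and br d
    and sV :: "'k \<Rightarrow> 'v::ab_group_add \<Rightarrow> 'v" and rho dV +
  fixes f :: "'g \<Rightarrow> 'g \<Rightarrow> 'g \<Rightarrow> 'g \<Rightarrow> 'g \<Rightarrow> 'v"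
    and g :: "'g \<Rightarrow> 'g \<Rightarrow> 'g \<Rightarrow> 'v"
  assumes f_multilinear: "quintilinear s sV f"
    and f_skew: "skew23 f"
    and g_trilinear: "trilinear s s s sV g"
    and g_skew: "skew3 g"
    and f_closed:
      "coboundary sV br rho (cochain_f f) [(x1, x2), (x3, x4), (x5, x6)] z = 0"
    and g_closed:
      "coboundary sV br (hat lam sV d rho) (cochain_g g) [(x1, x2), (x3, x4)] z
         - delta lam d sV dV f x1 x2 x3 x4 z = 0"

record ('k, 'g) diff_three_Lie =
  scale_g :: "'k \<Rightarrow> 'g \<Rightarrow> 'g"
  bracket :: "'g \<Rightarrow> 'g \<Rightarrow> 'g \<Rightarrow> 'g"
  diff_g :: "'g \<Rightarrow> 'g"

record ('k, 'g, 'v) diff_rep =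
  scale_V :: "'k \<Rightarrow> 'v \<Rightarrow> 'v"
  action :: "'g \<Rightarrow> 'g \<Rightarrow> 'v \<Rightarrow> 'v"
  diff_V :: "'v \<Rightarrow> 'v"

record ('g, 'v) cochain_pair =
  cochain5 :: "'g \<Rightarrow> 'g \<Rightarrow> 'g \<Rightarrow> 'g \<Rightarrow> 'g \<Rightarrow> 'v"
  cochain3 :: "'g \<Rightarrow> 'g \<Rightarrow> 'g \<Rightarrow> 'v"

text \<open>The predicate \<open>differential_three_Lie_cocycle\<close> includes the requirements that the first
  component is a differential 3-Lie algebra and the second one a representation of it.\<close>

definition three_cocycles ::
  "'k::field_char_0 \<Rightarrow> (('k, 'g::ab_group_add) diff_three_Lie \<times> ('k, 'g, 'v::ab_group_add) diff_rep
     \<times> ('g, 'v) cochain_pair) set" where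
  "three_cocycles lam =
     {(G, R, C). differential_three_Lie_cocycle lam (scale_g G) (bracket G) (diff_g G)
        (scale_V R) (action R) (diff_V R) (cochain5 C) (cochain3 C)}"


section \<open>Differential 3-Lie 2-algebras\<close>

text \<open>The map \<open>l\<^sub>3\<close> has one component for each distribution of the degrees over its arguments:
  \<open>l000\<close> for three arguments in \<open>g\<^sub>0\<close>, and \<open>l001\<close>, \<open>l010\<close>, \<open>l100\<close> for one argument in \<open>g\<^sub>1\<close> at the
  position of the digit 1.  The last four assumptions before \<open>h_l3\<close> are the skew-symmetry of
  \<open>l\<^sub>3\<close> on arguments of which one lies in \<open>g\<^sub>1\<close> (again for the adjacent transpositions).\<close>

locale three_Lie_2_algebra = g0: vector_space s0 + g1: vector_space s1
  for s0 :: "'k::field_char_0 \<Rightarrow> 'a::ab_group_add \<Rightarrow> 'a"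
    and s1 :: "'k \<Rightarrow> 'b::ab_group_add \<Rightarrow> 'b" +
  fixes h :: "'b \<Rightarrow> 'a"
    and l000 :: "'a \<Rightarrow> 'a \<Rightarrow> 'a \<Rightarrow> 'a"
    and l001 :: "'a \<Rightarrow> 'a \<Rightarrow> 'b \<Rightarrow> 'b"
    and l010 :: "'a \<Rightarrow> 'b \<Rightarrow> 'a \<Rightarrow> 'b"
    and l100 :: "'b \<Rightarrow> 'a \<Rightarrow> 'a \<Rightarrow> 'b"
    and l5 :: "'a \<Rightarrow> 'a \<Rightarrow> 'a \<Rightarrow> 'a \<Rightarrow> 'a \<Rightarrow> 'b"
  assumes h_linear: "Vector_Spaces.linear s1 s0 h"
    and l000_trilinear: "trilinear s0 s0 s0 s0 l000"
    and l001_trilinear: "trilinear s0 s0 s1 s1 l001"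
    and l010_trilinear: "trilinear s0 s1 s0 s1 l010"
    and l100_trilinear: "trilinear s1 s0 s0 s1 l100"
    and l5_multilinear: "quintilinear s0 s1 l5"
    and l5_skew: "skew23 l5"
    and l000_skew: "skew3 l000"
    and l001_skew: "l001 y x a = - l001 x y a"
    and l010_l001: "l010 x a y = - l001 x y a"
    and l100_l010: "l100 a x y = - l010 x a y"
    and l100_skew: "l100 a y x = - l100 a x y"
    and h_l3: "h (l001 x y a) = l000 x y (h a)"
    and l3_h: "l100 a (h b) x = l010 (h a) b x"
    and h_l5:
      "h (l5 x1 x2 x3 x4 x5) =
         - l000 x1 x2 (l000 x3 x4 x5) + l000 x3 (l000 x1 x2 x4) x5
         + l000 (l000 x1 x2 x3) x4 x5 + l000 x3 x4 (l000 x1 x2 x5)"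
    and l5_h_first:
      "l5 (h a) x2 x3 x4 x5 =
         - l100 a x2 (l000 x3 x4 x5) + l010 x3 (l100 a x2 x4) x5
         + l100 (l100 a x2 x3) x4 x5 + l001 x3 x4 (l100 a x2 x5)"
    and l5_h_third:
      "l5 x1 x2 (h a) x4 x5 =
         - l001 x1 x2 (l100 a x4 x5) + l100 a (l000 x1 x2 x4) x5
         + l100 (l001 x1 x2 a) x4 x5 + l100 a x4 (l000 x1 x2 x5)"
    and l5_l3:
      "l100 (l5 x1 x2 x3 x4 x5) x6 x7 + l010 x5 (l5 x1 x2 x3 x4 x6) x7
         + l001 x1 x2 (l5 x3 x4 x5 x6 x7) + l001 x5 x6 (l5 x1 x2 x3 x4 x7)
         + l5 x1 x2 (l000 x3 x4 x5) x6 x7 + l5 x1 x2 x5 (l000 x3 x4 x6) x7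
         + l5 x1 x2 x5 x6 (l000 x3 x4 x7)
       = l001 x3 x4 (l5 x1 x2 x5 x6 x7)
         + l5 (l000 x1 x2 x3) x4 x5 x6 x7 + l5 x3 (l000 x1 x2 x4) x5 x6 x7
         + l5 x3 x4 (l000 x1 x2 x5) x6 x7 + l5 x3 x4 x5 (l000 x1 x2 x6) x7
         + l5 x1 x2 x3 x4 (l000 x5 x6 x7) + l5 x3 x4 x5 x6 (l000 x1 x2 x7)"

locale differential_three_Lie_2_algebra =
  three_Lie_2_algebra s0 s1 h l000 l001 l010 l100 l5
  for lam :: "'k::field_char_0"
    and s0 :: "'k \<Rightarrow> 'a::ab_group_add \<Rightarrow> 'a"
    and s1 :: "'k \<Rightarrow> 'b::ab_group_add \<Rightarrow> 'b"
    and h l000 l001 l010 l100 l5 +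
  fixes d0 :: "'a \<Rightarrow> 'a"
    and d1 :: "'b \<Rightarrow> 'b"
    and d2 :: "'a \<Rightarrow> 'a \<Rightarrow> 'a \<Rightarrow> 'b"
  assumes d0_linear: "Vector_Spaces.linear s0 s0 d0"
    and d1_linear: "Vector_Spaces.linear s1 s1 d1"
    and d2_trilinear: "trilinear s0 s0 s0 s1 d2"
    and d2_skew: "skew3 d2"
    and d0_h: "d0 (h a) = h (d1 a)"
    and d0_l3:
      "h (d2 x1 x2 x3) + d0 (l000 x1 x2 x3) =
         l000 (d0 x1) x2 x3 + l000 x1 (d0 x2) x3 + l000 x1 x2 (d0 x3)
         + s0 lam (l000 (d0 x1) (d0 x2) x3 + l000 x1 (d0 x2) (d0 x3) + l000 (d0 x1) x2 (d0 x3))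
         + s0 (lam\<^sup>2) (l000 (d0 x1) (d0 x2) (d0 x3))"
    and d1_l3:
      "d2 x1 x2 (h a) + d1 (l001 x1 x2 a) =
         l001 (d0 x1) x2 a + l001 x1 (d0 x2) a + l001 x1 x2 (d1 a)
         + s1 lam (l001 (d0 x1) (d0 x2) a + l001 x1 (d0 x2) (d1 a) + l001 (d0 x1) x2 (d1 a))
         + s1 (lam\<^sup>2) (l001 (d0 x1) (d0 x2) (d1 a))"
    and d1_l5:
      "d1 (l5 x1 x2 x3 x4 x5)
         - (\<Sum>k=1..5. s1 (lam ^ (k - 1)) (entries_sum d0 l5 k x1 x2 x3 x4 x5))
       = d2 x3 (l000 x1 x2 x4) x5 + d2 (l000 x1 x2 x3) x4 x5 + d2 x3 x4 (l000 x1 x2 x5)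
         - d2 x1 x2 (l000 x3 x4 x5)
         - hat lam s1 d0 l001 x1 x2 (d2 x3 x4 x5) + hat lam s1 d0 l001 x5 x3 (d2 x1 x2 x4)
         + hat lam s1 d0 l001 x4 x5 (d2 x1 x2 x3) + hat lam s1 d0 l001 x3 x4 (d2 x1 x2 x5)"

record ('k, 'a, 'b) diff_three_Lie_2 =
  scale_0 :: "'k \<Rightarrow> 'a \<Rightarrow> 'a"
  scale_1 :: "'k \<Rightarrow> 'b \<Rightarrow> 'b"
  hmap :: "'b \<Rightarrow> 'a"
  l3_000 :: "'a \<Rightarrow> 'a \<Rightarrow> 'a \<Rightarrow> 'a"
  l3_001 :: "'a \<Rightarrow> 'a \<Rightarrow> 'b \<Rightarrow> 'b"
  l3_010 :: "'a \<Rightarrow> 'b \<Rightarrow> 'a \<Rightarrow> 'b"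
  l3_100 :: "'b \<Rightarrow> 'a \<Rightarrow> 'a \<Rightarrow> 'b"
  l5_map :: "'a \<Rightarrow> 'a \<Rightarrow> 'a \<Rightarrow> 'a \<Rightarrow> 'a \<Rightarrow> 'b"
  diff_0 :: "'a \<Rightarrow> 'a"
  diff_1 :: "'b \<Rightarrow> 'b"
  diff_2 :: "'a \<Rightarrow> 'a \<Rightarrow> 'a \<Rightarrow> 'b"

definition skeletal :: "('k, 'a::ab_group_add, 'b) diff_three_Lie_2 \<Rightarrow> bool" where
  "skeletal A \<longleftrightarrow> (\<forall>a. hmap A a = 0)"

definition diff_three_Lie_2_algebras ::
  "'k::field_char_0 \<Rightarrow> ('k, 'a::ab_group_add, 'b::ab_group_add) diff_three_Lie_2 set" where
  "diff_three_Lie_2_algebras lam =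
     {A. differential_three_Lie_2_algebra lam (scale_0 A) (scale_1 A) (hmap A)
           (l3_000 A) (l3_001 A) (l3_010 A) (l3_100 A) (l5_map A)
           (diff_0 A) (diff_1 A) (diff_2 A)}"

text \<open>The correspondence: \<open>g\<^sub>0\<close> with \<open>l\<^sub>3\<close> and \<open>d\<^sub>0\<close> is the algebra, \<open>g\<^sub>1\<close> with
  \<open>\<rho>(x, y) a = l\<^sub>3(x, y, a)\<close> and \<open>d\<^sub>1\<close> is the representation, and \<open>(l\<^sub>5, d\<^sub>2)\<close> is the cocycle.\<close>

definition cocycle_of ::
  "('k, 'a, 'b) diff_three_Lie_2 \<Rightarrow>
     ('k, 'a) diff_three_Lie \<times> ('k, 'a, 'b) diff_rep \<times> ('a, 'b) cochain_pair" where
  "cocycle_of A =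
     (\<lparr>scale_g = scale_0 A, bracket = l3_000 A, diff_g = diff_0 A\<rparr>,
      \<lparr>scale_V = scale_1 A, action = l3_001 A, diff_V = diff_1 A\<rparr>,
      \<lparr>cochain5 = l5_map A, cochain3 = diff_2 A\<rparr>)"

end

theory Submission
  imports Defs
begin

text \<open>With \<open>h = 0\<close> the equations of a 3-Lie 2-algebra decouple: (2) becomes the fundamental
  identity, (3) and (4) become the two axioms of a representation, (5) reads \<open>\<partial> l\<^sub>5 = 0\<close>, (6) and
  (7) say that \<open>d\<^sub>0\<close> and \<open>d\<^sub>1\<close> are differentials, and (8) reads
  \<open>- \<delta> l\<^sub>5 = - \<partial>\<^sub>\<lambda> d\<^sub>2\<close>.  Skew-symmetry recovers \<open>l\<^sub>3\<close> on \<open>g\<^sub>0 \<otimes> g\<^sub>1 \<otimes> g\<^sub>0\<close> and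
  \<open>g\<^sub>1 \<otimes> g\<^sub>0 \<otimes> g\<^sub>0\<close> from the action.\<close>

text \<open>Makes the case p = 2 explicit, for comparison with \<open>d1_l5\<close>. The action
  \<open>rho\<close> stays arbitrary so that its \<open>hat\<close> version can be substituted. The
  sign \<open>(-1) ^ (p + 1)\<close> makes the last two terms negative.\<close>

lemma coboundary_cochain_g:
  assumes "vector_space sV"
  shows "coboundary sV br rho (cochain_g g) [(x1, x2), (x3, x4)] x5 =
    - g x3 (br x1 x2 x4) x5 - g (br x1 x2 x3) x4 x5
    - g x3 x4 (br x1 x2 x5) + g x1 x2 (br x3 x4 x5)
    + rho x1 x2 (g x3 x4 x5) - rho x3 x4 (g x1 x2 x5)
    - rho x4 x5 (g x1 x2 x3) - rho x5 x3 (g x1 x2 x4)"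
proof -
  interpret vector_space sV by fact
  show ?thesis
    by (simp add: coboundary_def cochain_g_def bracket_F_def omit_def numeral_2_eq_2
        sum.atLeast_Suc_atMost sum.atLeast_Suc_lessThan algebra_simps)
qed

text \<open>For p = 3 the same sign is positive. The last two terms correspond to those of
  \<open>l5_l3\<close> where a value of \<open>l5\<close> is the first or second argument of the
  ternary bracket.\<close>

lemma coboundary_cochain_f:
  assumes "vector_space sV"
  shows "coboundary sV br rho (cochain_f f) [(x1, x2), (x3, x4), (x5, x6)] x7 =
    - f x3 (br x1 x2 x4) x5 x6 x7 - f (br x1 x2 x3) x4 x5 x6 x7
    - f x3 x4 x5 (br x1 x2 x6) x7 - f x3 x4 (br x1 x2 x5) x6 x7
    + f x1 x2 x5 (br x3 x4 x6) x7 + f x1 x2 (br x3 x4 x5) x6 x7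
    - f x3 x4 x5 x6 (br x1 x2 x7) + f x1 x2 x5 x6 (br x3 x4 x7)
    - f x1 x2 x3 x4 (br x5 x6 x7)
    + rho x1 x2 (f x3 x4 x5 x6 x7) - rho x3 x4 (f x1 x2 x5 x6 x7)
    + rho x5 x6 (f x1 x2 x3 x4 x7)
    + rho x6 x7 (f x1 x2 x3 x4 x5) + rho x7 x5 (f x1 x2 x3 x4 x6)"
proof -
  interpret vector_space sV by fact
  show ?thesis
    by (simp add: coboundary_def cochain_f_def bracket_F_def omit_def numeral_2_eq_2 numeral_3_eq_3
        sum.atLeast_Suc_atMost sum.atLeast_Suc_lessThan algebra_simps)
qed

lemma linear_map_zero:
  assumes "Vector_Spaces.linear s t f"
  shows "f 0 = 0"
proof -
  interpret Vector_Spaces.linear s t f by fact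
  show ?thesis by (rule zero)
qed

lemma trilinear_zero:
  assumes "trilinear s1 s2 s3 t f"
  shows "f 0 y z = 0" "f x 0 z = 0" "f x y 0 = 0"
proof -
  have "Vector_Spaces.linear s1 t (\<lambda>x. f x y z)"
    "Vector_Spaces.linear s2 t (\<lambda>y. f x y z)"
    "Vector_Spaces.linear s3 t (\<lambda>z. f x y z)"
    using assms unfolding trilinear_def by blast+
  from this[THEN linear_map_zero] show "f 0 y z = 0" "f x 0 z = 0" "f x y 0 = 0" .
qed

text \<open>These are the two slots where \<open>l5_h_first\<close> and \<open>l5_h_third\<close>
  insert \<open>h a\<close>.\<close>

lemma quintilinear_zero:
  assumes "quintilinear s t f"
  shows "f 0 x2 x3 x4 x5 = 0" "f x1 x2 0 x4 x5 = 0"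
proof -
  have "Vector_Spaces.linear s t (\<lambda>x. f x x2 x3 x4 x5)"
    "Vector_Spaces.linear s t (\<lambda>x. f x1 x2 x x4 x5)"
    using assms unfolding quintilinear_def by blast+
  from this[THEN linear_map_zero]
  show "f 0 x2 x3 x4 x5 = 0" "f x1 x2 0 x4 x5 = 0" .
qed

lemma linear_uminus:
  assumes "Vector_Spaces.linear s t f"
  shows "Vector_Spaces.linear s t (\<lambda>x. - f x)"
proof -
  interpret Vector_Spaces.linear s t f by fact
  show ?thesis by unfold_locales (simp_all add: add scale)
qed

lemma differential_three_Lie_cocycle_of_skeletal:
  assumes "differential_three_Lie_2_algebra lam s0 s1 h l000 l001 l010 l100 l5 d0 d1 d2"
    and h: "\<And>a. h a = 0"
  shows "differential_three_Lie_cocycle lam s0 l000 d0 s1 l001 d1 l5 d2"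
proof -
  interpret differential_three_Lie_2_algebra lam s0 s1 h l000 l001 l010 l100 l5 d0 d1 d2 by fact
  interpret d0: Vector_Spaces.linear s0 s0 d0 by (fact d0_linear)
  interpret d1: Vector_Spaces.linear s1 s1 d1 by (fact d1_linear)
  \<comment> \<open>Moving the degree-1 argument to the end takes one transposition from the middle
    and two from the front, hence the signs.\<close>
  have l010: "l010 x a y = - l001 x y a" and l100: "l100 a x y = l001 x y a" for x y a
    by (simp_all add: l010_l001 l100_l010)
  have vs: "vector_space s1" by unfold_locales
  note l5_0 = quintilinear_zero[OF l5_multilinear]
  note d2_0 = trilinear_zero(3)[OF d2_trilinear]
  show ?thesis
  proof unfold_locales
    fix x1 x2 y1 y2 y3
    show "l000 x1 x2 (l000 y1 y2 y3) = l000 (l000 x1 x2 y1) y2 y3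
      + l000 y1 (l000 x1 x2 y2) y3 + l000 y1 y2 (l000 x1 x2 y3)"
      using h_l5[of x1 x2 y1 y2 y3] by (simp add: h algebra_simps)
  next
    fix x1 x2 x3
    show "d0 (l000 x1 x2 x3) =
       l000 (d0 x1) x2 x3 + l000 x1 (d0 x2) x3 + l000 x1 x2 (d0 x3) +
       s0 lam (l000 (d0 x1) (d0 x2) x3) + s0 lam (l000 x1 (d0 x2) (d0 x3)) +
       s0 lam (l000 (d0 x1) x2 (d0 x3)) + s0 (lam\<^sup>2) (l000 (d0 x1) (d0 x2) (d0 x3))"
      using d0_l3[of x1 x2 x3] by (simp add: h algebra_simps g0.scale_right_distrib)
  next
    fix x1 x2 x3 x4 v
    show "l001 x1 x2 (l001 x3 x4 v) =
       l001 (l000 x1 x2 x3) x4 v + l001 x3 (l000 x1 x2 x4) v + l001 x3 x4 (l001 x1 x2 v)"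
      using l5_h_third[of x1 x2 v x3 x4] by (simp add: h l5_0 l100 algebra_simps)
    \<comment> \<open>The \<open>l5\<close> term vanishes because \<open>h v = 0\<close>; the minus
      sign on the right comes from the single \<open>l010\<close> term of
      \<open>l5_h_first\<close>.\<close>
    show "l001 x1 (l000 x2 x3 x4) v =
       l001 x3 x4 (l001 x1 x2 v) - l001 x2 x4 (l001 x1 x3 v) + l001 x2 x3 (l001 x1 x4 v)"
      using l5_h_first[of v x1 x2 x3 x4] by (simp add: h l5_0 l100 l010 algebra_simps)
  next
    fix x1 x2 v
    show "d1 (l001 x1 x2 v) =
       l001 (d0 x1) x2 v + l001 x1 (d0 x2) v + s1 lam (l001 (d0 x1) (d0 x2) v) +
       l001 x1 x2 (d1 v) + s1 lam (l001 (d0 x1) x2 (d1 v) + l001 x1 (d0 x2) (d1 v) +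
               s1 lam (l001 (d0 x1) (d0 x2) (d1 v)))"
      using d1_l3[of x1 x2 v]
      by (simp add: h d2_0 algebra_simps g1.scale_right_distrib power2_eq_square)
  next
    fix x1 x2 x3 x4 x5 x6 z
    \<comment> \<open>The coboundary contains \<open>l001 z x5\<close> while \<open>l5_l3\<close>
      yields \<open>- l001 x5 z\<close>, so one use of skew-symmetry reconciles them.\<close>
    show "coboundary s1 l000 l001 (cochain_f l5) [(x1, x2), (x3, x4), (x5, x6)] z = 0"
      using l5_l3[of x1 x2 x3 x4 x5 x6 z] l001_skew[of x5 z]
      by (simp add: coboundary_cochain_f[OF vs] l010 l100 algebra_simps)
  next
    fix x1 x2 x3 x4 z
    \<comment> \<open>This is \<open>d1_l5\<close> with all terms moved to one side. Both
      \<open>hat\<close> and the sum over chosen entries occur identically in the two equations and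
      stay folded.\<close>
    show "coboundary s1 l000 (hat lam s1 d0 l001) (cochain_g d2) [(x1, x2), (x3, x4)] z
        - delta lam d0 s1 d1 l5 x1 x2 x3 x4 z = 0"
      using d1_l5[of x1 x2 x3 x4 z]
      by (simp add: coboundary_cochain_g[OF vs] delta_def algebra_simps)
  next
    fix v
    show "skew2 (\<lambda>x y. l001 x y v)"
      unfolding skew2_def using l001_skew by blast
  qed (fact l000_trilinear l001_trilinear l5_multilinear d2_trilinear
      l000_skew l5_skew d2_skew)+
qed

lemma skeletal_of_differential_three_Lie_cocycle:
  assumes "differential_three_Lie_cocycle lam s br d sV rho dV f g"
  shows "differential_three_Lie_2_algebra lam s sV (\<lambda>a. 0) br rho
    (\<lambda>x a y. - rho x y a) (\<lambda>a x y. rho x y a) f d dV g"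
proof -
  interpret differential_three_Lie_cocycle lam s br d sV rho dV f g by fact
  have vs: "vector_space sV" by unfold_locales
  interpret d: Vector_Spaces.linear s s d by (fact d_linear)
  interpret dV: Vector_Spaces.linear sV sV dV by (fact dV_linear)
  note f_0 = quintilinear_zero[OF f_multilinear]
  note g_0 = trilinear_zero(3)[OF g_trilinear]
  note rho_0 = trilinear_zero[OF rho_trilinear]
  note br_0 = trilinear_zero[OF br_trilinear]
  have skew: "rho y x a = - rho x y a" for x y a
    using rho_skew unfolding skew2_def by blast
  show ?thesis
  proof unfold_locales
    show "trilinear s sV s sV (\<lambda>x a y. - rho x y a)"
      using rho_trilinear by (simp add: trilinear_def linear_uminus)
    show "trilinear sV s s sV (\<lambda>a x y. rho x y a)"
      using rho_trilinear by (simp add: trilinear_def)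
  next
    fix x1 x2 x3 x4 x5
    show "0 = - br x1 x2 (br x3 x4 x5) + br x3 (br x1 x2 x4) x5
      + br (br x1 x2 x3) x4 x5 + br x3 x4 (br x1 x2 x5)"
      \<comment> \<open>Fixing the outer pair keeps the rewriting finite: the right side again
        contains a nested bracket, but with a different outer pair.\<close>
      by (simp add: fundamental_identity[of x1 x2])
    show "dV (f x1 x2 x3 x4 x5)
       - (\<Sum>k=1..5. sV (lam ^ (k - 1)) (entries_sum d f k x1 x2 x3 x4 x5))
       = g x3 (br x1 x2 x4) x5 + g (br x1 x2 x3) x4 x5 + g x3 x4 (br x1 x2 x5)
         - g x1 x2 (br x3 x4 x5)
         - hat lam sV d rho x1 x2 (g x3 x4 x5) + hat lam sV d rho x5 x3 (g x1 x2 x4)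
         + hat lam sV d rho x4 x5 (g x1 x2 x3) + hat lam sV d rho x3 x4 (g x1 x2 x5)"
      using g_closed[of x1 x2 x3 x4 x5]
      by (simp add: coboundary_cochain_g[OF vs] delta_def algebra_simps)
  next
    fix a x2 x3 x4 x5
    show "f 0 x2 x3 x4 x5 = - rho x2 (br x3 x4 x5) a + - rho x3 x5 (rho x2 x4 a)
      + rho x4 x5 (rho x2 x3 a) + rho x3 x4 (rho x2 x5 a)"
      by (simp add: f_0 rho_br)
  next
    fix x1 x2 a x4 x5
    show "f x1 x2 0 x4 x5 = - rho x1 x2 (rho x4 x5 a) + rho (br x1 x2 x4) x5 a
      + rho x4 x5 (rho x1 x2 a) + rho x4 (br x1 x2 x5) a"
      \<comment> \<open>The outer pair is fixed for the same reason: \<open>rho_rho\<close> has a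
        composite of two actions on both sides.\<close>
      by (simp add: f_0 rho_rho[of x1 x2])
  next
    fix x1 x2 x3 x4 x5 x6 x7
    show "rho x6 x7 (f x1 x2 x3 x4 x5) + - rho x5 x7 (f x1 x2 x3 x4 x6)
         + rho x1 x2 (f x3 x4 x5 x6 x7) + rho x5 x6 (f x1 x2 x3 x4 x7)
         + f x1 x2 (br x3 x4 x5) x6 x7 + f x1 x2 x5 (br x3 x4 x6) x7
         + f x1 x2 x5 x6 (br x3 x4 x7)
       = rho x3 x4 (f x1 x2 x5 x6 x7)
         + f (br x1 x2 x3) x4 x5 x6 x7 + f x3 (br x1 x2 x4) x5 x6 x7
         + f x3 x4 (br x1 x2 x5) x6 x7 + f x3 x4 x5 (br x1 x2 x6) x7
         + f x1 x2 x3 x4 (br x5 x6 x7) + f x3 x4 x5 x6 (br x1 x2 x7)"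
      using f_closed[of x1 x2 x3 x4 x5 x6 x7] skew[of x5 x7]
      by (simp add: coboundary_cochain_f[OF vs] algebra_simps)
  next
    fix x1 x2 x3
    show "0 + d (br x1 x2 x3) =
         br (d x1) x2 x3 + br x1 (d x2) x3 + br x1 x2 (d x3)
         + s lam (br (d x1) (d x2) x3 + br x1 (d x2) (d x3) + br (d x1) x2 (d x3))
         + s (lam\<^sup>2) (br (d x1) (d x2) (d x3))"
      by (simp add: d_br g.scale_right_distrib)
  next
    fix x1 x2 a
    show "g x1 x2 0 + dV (rho x1 x2 a) =
         rho (d x1) x2 a + rho x1 (d x2) a + rho x1 x2 (dV a)
         + sV lam (rho (d x1) (d x2) a + rho x1 (d x2) (dV a) + rho (d x1) x2 (dV a))
         + sV (lam\<^sup>2) (rho (d x1) (d x2) (dV a))"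
      by (simp add: g_0 dV_rho V.scale_right_distrib power2_eq_square algebra_simps)
  \<comment> \<open>Besides the inherited axioms, what remains is linearity of the zero map, its
    compatibility with brackets and differentials (both sides are 0), and the sign rules linking the
    components of the ternary bracket.\<close>
  qed (fact br_trilinear rho_trilinear f_multilinear g_trilinear
      br_skew f_skew g_skew skew | simp add: rho_0 br_0 d.zero)+
qed

theorem theorem6p3:
  fixes lam :: "'k::field_char_0"
  shows "bij_betw
    (cocycle_of :: ('k, 'a::ab_group_add, 'b::ab_group_add) diff_three_Lie_2 \<Rightarrow> _)
    {A \<in> diff_three_Lie_2_algebras lam. skeletal A}
    (three_cocycles lam)"
proof -
  let ?inv = "\<lambda>(G :: ('k, 'a) diff_three_Lie, R :: ('k, 'a, 'b) diff_rep, C :: ('a, 'b) cochain_pair).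
    \<lparr>scale_0 = scale_g G, scale_1 = scale_V R, hmap = \<lambda>a. 0, l3_000 = bracket G,
     l3_001 = action R, l3_010 = \<lambda>x a y. - action R x y a, l3_100 = \<lambda>a x y. action R x y a,
     l5_map = cochain5 C, diff_0 = diff_g G, diff_1 = diff_V R, diff_2 = cochain3 C\<rparr>"
  show ?thesis
  proof (rule bij_betw_byWitness[where f' = ?inv])
    show "\<forall>A \<in> {A \<in> diff_three_Lie_2_algebras lam. skeletal A}. ?inv (cocycle_of A) = A"
    proof safe
      fix A :: "('k, 'a, 'b) diff_three_Lie_2"
      assume A: "A \<in> diff_three_Lie_2_algebras lam" "skeletal A"
      interpret differential_three_Lie_2_algebra lam "scale_0 A" "scale_1 A" "hmap A"
        "l3_000 A" "l3_001 A" "l3_010 A" "l3_100 A" "l5_map A" "diff_0 A" "diff_1 A" "diff_2 A"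
        using A by (simp add: diff_three_Lie_2_algebras_def)
      \<comment> \<open>\<open>cocycle_of\<close> forgets exactly three fields: these two are forced
        by skew-symmetry, and \<open>hmap A\<close> by skeletality.\<close>
      have "l3_010 A = (\<lambda>x a y. - l3_001 A x y a)" "l3_100 A = (\<lambda>a x y. l3_001 A x y a)"
        by (intro ext, simp add: l010_l001 l100_l010)+
      moreover have "hmap A = (\<lambda>a. 0)"
        using A by (auto simp: skeletal_def)
      ultimately show "?inv (cocycle_of A) = A"
        by (simp add: cocycle_of_def)
    qed
    show "\<forall>T \<in> three_cocycles lam. cocycle_of (?inv T) = T"
      by (auto simp: cocycle_of_def)
    show "cocycle_of ` {A \<in> diff_three_Lie_2_algebras lam. skeletal A} \<subseteq> three_cocycles lam"
      by (auto simp: diff_three_Lie_2_algebras_def skeletal_def three_cocycles_def cocycle_of_def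
          intro: differential_three_Lie_cocycle_of_skeletal)
    show "?inv ` three_cocycles lam \<subseteq> {A \<in> diff_three_Lie_2_algebras lam. skeletal A}"
      by (auto simp: diff_three_Lie_2_algebras_def skeletal_def three_cocycles_def
          intro: skeletal_of_differential_three_Lie_cocycle)
  qed
qed

end
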